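(* Let $\hat\pi$ be the density of the Gaussian distribution $\mathcal{N}(\boldsymbol{\mu},P)$ on $\mathbb{R}^n$, let $\boldsymbol{a}\in\mathbb{R}^n$ and $b\in\mathbb{R}$ with $\boldsymbol{a}^\top P\boldsymbol{a}>0$, and let $\mathcal{S}=\{\boldsymbol{x}\in\mathbb{R}^n : \boldsymbol{a}^\top\boldsymbol{x}\le b\}$. Let $\pi$ be a probability density on $\mathbb{R}^n$ with $R(\pi\|\hat\pi)<\infty$, and let $\lambda>0$. Then $$\mathbb{P}_{\boldsymbol{x}\sim\pi}[\boldsymbol{x}\notin\mathcal{S}]\;\le\;1+\frac1\lambda\left\{\ln\left(1-(1-e^{-\lambda})\,\operatorname{cdf}\left(\frac{b-\boldsymbol{a}^\top\boldsymbol{\mu}}{\sqrt{\boldsymbol{a}^\top P\boldsymbol{a}}}\right)\right)+R(\pi\|\hat\pi)\right\}.$$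
   Context: $\operatorname{cdf}(\cdot)$ denotes the cumulative distribution function of the standard normal distribution. The relative entropy is $R(\pi\|\hat\pi)=\int_{\mathbb{R}^n}\pi\ln(\pi/\hat\pi)\,d\boldsymbol{x}$. $\pi$ is the true (unknown) state density at a fixed time, $\hat\pi$ the Gaussian reference density with mean $\boldsymbol{\mu}$ and covariance matrix $P$ (positive definite) at that time. *)

theory Defs
  imports "HOL-Probability.Probability"
begin

definition pos_def_matrix :: "real^'n^'n \<Rightarrow> bool" where
  "pos_def_matrix P \<longleftrightarrow> transpose P = P \<and> (\<forall>x. x \<noteq> 0 \<longrightarrow> x \<bullet> (P *v x) > 0)"

definition gaussian_density :: "real^'n \<Rightarrow> real^'n^'n \<Rightarrow> real^'n \<Rightarrow> real" where
  "gaussian_density \<mu> P x =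
     exp (- (1/2) * ((x - \<mu>) \<bullet> (matrix_inv P *v (x - \<mu>)))) / sqrt ((2 * pi) ^ CARD('n) * det P)"

definition prob_density :: "(real^'n \<Rightarrow> real) \<Rightarrow> bool" where
  "prob_density p \<longleftrightarrow> p \<in> borel_measurable borel \<and> (\<forall>x. 0 \<le> p x) \<and>
     (\<integral>\<^sup>+x. ennreal (p x) \<partial>lborel) = 1"

(* The integral of p * ln (p / q) in the extended reals, as positive part minus negative part;
   for probability densities the negative part is always finite, since p * ln (p / q) \<ge> p - q.
   HOL's KL_divergence is real-valued and cannot express finiteness. The first test is needed
   because p / 0 = 0 in HOL: the value is infinite unless p vanishes almost everywhere where q does. *)
definition relative_entropy :: "(real^'n \<Rightarrow> real) \<Rightarrow> (real^'n \<Rightarrow> real) \<Rightarrow> ereal" where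
  "relative_entropy p q =
     (if AE x in lborel. q x = 0 \<longrightarrow> p x = 0 then
        enn2ereal (\<integral>\<^sup>+x. ennreal (p x * ln (p x / q x)) \<partial>lborel)
        - enn2ereal (\<integral>\<^sup>+x. ennreal (- (p x * ln (p x / q x))) \<partial>lborel)
      else \<infinity>)"

end

theory Submission
  imports Defs
begin

text \<open>
  Two facts combine. The Donsker--Varadhan inequality bounds the mean of a bounded function
  \<open>f\<close> under \<open>p\<close> by the log-exponential mean of \<open>f\<close> under \<open>q\<close> plus the relative entropy of
  \<open>p\<close> with respect to \<open>q\<close> (\<open>donsker_varadhan_le\<close>). With \<open>f = - lam * indicator S\<close> the exponential
  mean is \<open>1 - (1 - exp (- lam)) * q(S)\<close>, while the mean under \<open>p\<close> is \<open>- lam * (1 - p(-S))\<close>;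
  dividing by \<open>lam\<close> gives the bound, with \<open>q(S)\<close> the Gaussian probability of the halfspace.

  That probability is a value of the standard normal distribution function because the normalised
  functional \<open>u = a / sqrt (a \<bullet> (P *v a))\<close> of a centred Gaussian vector is standard normal
  (\<open>nn_integral_gaussian_linear_functional\<close>). To see this, complete \<open>u\<close> to a basis orthonormal for
  the inner product \<open>x \<bullet> (P *v y)\<close> and let \<open>V\<close> have these vectors as rows (\<open>pos_def_whitening\<close>). The
  substitution \<open>y = V *v (x - \<mu>)\<close> turns the Gaussian density into a product of standard normal
  densities and \<open>u \<bullet> (x - \<mu>)\<close> into one coordinate of \<open>y\<close>, so the integral factorises. The
  Jacobian of the substitution comes from \<open>nn_integral_lborel_matrix\<close>.
\<close>

section \<open>The Donsker--Varadhan inequality\<close>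

text \<open>
  With \<open>c = f - ln Z\<close> this is the integrand of the Donsker--Varadhan inequality: the left-hand side
  is the tangent to the convex function \<open>p \<mapsto> p * ln (p / q)\<close> at \<open>p = q * exp c\<close>. With \<open>c = 0\<close> it
  shows that the negative part of the relative entropy is at most the mass of \<open>q\<close>.
\<close>

lemma exp_linear_gap_le_mult_ln:
  fixes p q c :: real
  assumes "0 \<le> p" and "0 < q"
  shows "p - q * exp c + p * c \<le> p * ln (p / q)"
proof (cases "p = 0")
  case True
  then show ?thesis using assms by simp
next
  case False
  with assms have "0 < p" by simp
  have "p * ln (q * exp c / p) \<le> p * (q * exp c / p - 1)"
    using \<open>0 < p\<close> assms by (intro mult_left_mono ln_le_minus_one) auto
  also have "\<dots> = q * exp c - p" using \<open>0 < p\<close> by (simp add: field_simps)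
  finally show ?thesis
    using \<open>0 < p\<close> assms by (simp add: ln_div ln_mult algebra_simps)
qed

text \<open>
  Only the positive part of the relative entropy can be infinite, so finiteness makes the integrand
  Lebesgue integrable and the extended-real value a genuine real integral.
\<close>

lemma relative_entropy_eq_integral:
  assumes p: "prob_density p" and q: "prob_density q" and qpos: "\<And>x. 0 < q x"
    and fin: "relative_entropy p q < \<infinity>"
  shows "integrable lborel (\<lambda>x. p x * ln (p x / q x))"
    and "relative_entropy p q = ereal (\<integral>x. p x * ln (p x / q x) \<partial>lborel)"
proof -
  let ?h = "\<lambda>x. p x * ln (p x / q x)"
  have [measurable]: "p \<in> borel_measurable borel" "q \<in> borel_measurable borel"
    and p0: "\<And>x. 0 \<le> p x"
    using p q by (auto simp: prob_density_def)
  have re: "relative_entropy p q =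
      enn2ereal (\<integral>\<^sup>+x. ennreal (?h x) \<partial>lborel) - enn2ereal (\<integral>\<^sup>+x. ennreal (- ?h x) \<partial>lborel)"
    unfolding relative_entropy_def using qpos by (simp add: less_imp_neq[symmetric] AE_I2)
  have "- ?h x \<le> q x" for x
    using exp_linear_gap_le_mult_ln[OF p0[of x] qpos[of x], of 0] p0[of x] by simp
  then have "(\<integral>\<^sup>+x. ennreal (- ?h x) \<partial>lborel) \<le> (\<integral>\<^sup>+x. ennreal (q x) \<partial>lborel)"
    by (intro nn_integral_mono ennreal_leI)
  also have "\<dots> = 1" using q by (simp add: prob_density_def)
  finally have neg: "(\<integral>\<^sup>+x. ennreal (- ?h x) \<partial>lborel) < \<infinity>"
    by (simp add: le_less_trans)
  have pos: "(\<integral>\<^sup>+x. ennreal (?h x) \<partial>lborel) < \<infinity>"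
  proof (rule ccontr)
    assume "\<not> ?thesis"
    then have "(\<integral>\<^sup>+x. ennreal (?h x) \<partial>lborel) = \<infinity>" by (simp add: less_top[symmetric])
    with re fin neg show False
      by (cases "\<integral>\<^sup>+x. ennreal (- ?h x) \<partial>lborel") auto
  qed
  show int: "integrable lborel ?h"
    using pos neg by (auto simp: real_integrable_def)
  show "relative_entropy p q = ereal (\<integral>x. ?h x \<partial>lborel)"
    unfolding re real_lebesgue_integral_def[OF int]
    using pos neg
    by (cases "\<integral>\<^sup>+x. ennreal (?h x) \<partial>lborel"; cases "\<integral>\<^sup>+x. ennreal (- ?h x) \<partial>lborel") auto
qed

lemma prob_density_integral:
  assumes "prob_density p"
  shows "integrable lborel p" and "(\<integral>x. p x \<partial>lborel) = 1"
  using assms unfolding prob_density_def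
  by (auto intro!: integrableI_nonneg integral_eq_nn_integral[THEN trans])

text \<open>
  Integrating the tangent inequality at the tilted density \<open>q * exp f / Z\<close>, where \<open>Z\<close> normalises it:
  the masses of \<open>p\<close> and of the tilted density cancel. Boundedness of \<open>f\<close> makes every term integrable
  and \<open>Z\<close> positive.
\<close>

lemma donsker_varadhan_le:
  assumes p: "prob_density p" and q: "prob_density q" and qpos: "\<And>x. 0 < q x"
    and fin: "relative_entropy p q < \<infinity>"
    and f[measurable]: "f \<in> borel_measurable borel" and bound: "\<And>x. \<bar>f x\<bar> \<le> B"
  shows "ereal (\<integral>x. p x * f x \<partial>lborel)
    \<le> ereal (ln (\<integral>x. q x * exp (f x) \<partial>lborel)) + relative_entropy p q"
proof -
  have [measurable]: "p \<in> borel_measurable borel" "q \<in> borel_measurable borel"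
    and p0: "\<And>x. 0 \<le> p x"
    using p q by (auto simp: prob_density_def)
  note ip = prob_density_integral[OF p] and iq = prob_density_integral[OF q]
  note re = relative_entropy_eq_integral[OF p q qpos fin]
  define Z where "Z = (\<integral>x. q x * exp (f x) \<partial>lborel)"
  have ipf: "integrable lborel (\<lambda>x. p x * f x)"
    by (rule Bochner_Integration.integrable_bound[OF integrable_mult_right[OF ip(1), of B]])
       (use p0 order.trans[OF bound abs_ge_self] in \<open>auto simp: abs_mult mult.commute[of "p _"] intro!: AE_I2 mult_right_mono\<close>)
  have iqe: "integrable lborel (\<lambda>x. q x * exp (f x))"
  proof (rule Bochner_Integration.integrable_bound[OF integrable_mult_right[OF iq(1), of "exp B"]])
    show "AE x in lborel. norm (q x * exp (f x)) \<le> norm (exp B * q x)"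
    proof (rule AE_I2)
      fix x
      show "norm (q x * exp (f x)) \<le> norm (exp B * q x)"
        using qpos[of x] order.trans[OF abs_ge_self bound, of x] by (simp add: abs_mult mult.commute)
    qed
  qed simp
  have "exp (- B) = (\<integral>x. exp (- B) * q x \<partial>lborel)" using iq by simp
  also have "\<dots> \<le> Z" unfolding Z_def
  proof (rule integral_mono[OF integrable_mult_right[OF iq(1)] iqe])
    fix x
    have "- B \<le> f x" using bound[of x] by linarith
    then show "exp (- B) * q x \<le> q x * exp (f x)" using qpos[of x] by simp
  qed
  finally have Z: "0 < Z" by (rule less_le_trans[OF exp_gt_zero])
  have "(\<integral>x. p x - (q x * exp (f x)) / Z + (p x * f x - p x * ln Z) \<partial>lborel)
      \<le> (\<integral>x. p x * ln (p x / q x) \<partial>lborel)"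
  proof (rule integral_mono[OF _ re(1)])
    show "integrable lborel (\<lambda>x. p x - (q x * exp (f x)) / Z + (p x * f x - p x * ln Z))"
      using ip ipf iqe by auto
    fix x
    show "p x - (q x * exp (f x)) / Z + (p x * f x - p x * ln Z) \<le> p x * ln (p x / q x)"
      using exp_linear_gap_le_mult_ln[OF p0[of x] qpos[of x], of "f x - ln Z"] Z
      by (simp add: exp_diff algebra_simps)
  qed
  also have "(\<integral>x. p x - (q x * exp (f x)) / Z + (p x * f x - p x * ln Z) \<partial>lborel)
      = 1 - Z / Z + ((\<integral>x. p x * f x \<partial>lborel) - ln Z)"
    using ip ipf iqe by (simp add: Z_def)
  finally show ?thesis
    unfolding re(2) using Z by (simp add: Z_def)
qed


section \<open>Linear change of variables for Lebesgue measure\<close>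

text \<open>
  Integrate first along \<open>e\<close>: there \<open>h\<close> is constant, and the shear is a translation of the real line.
\<close>

lemma nn_integral_lborel_shear:
  fixes e :: "'a::euclidean_space" and h :: "'a \<Rightarrow> real" and g :: "'a \<Rightarrow> ennreal"
  assumes e: "e \<in> Basis"
    and g[measurable]: "g \<in> borel_measurable borel" and h[measurable]: "h \<in> borel_measurable borel"
    and h_inv: "\<And>x t. h (x + t *\<^sub>R e) = h x"
  shows "(\<integral>\<^sup>+x. g (x + h x *\<^sub>R e) \<partial>lborel) = (\<integral>\<^sup>+x. g x \<partial>lborel)"
proof -
  interpret product_sigma_finite "\<lambda>_::'a. lborel :: real measure" ..
  define w :: "('a \<Rightarrow> real) \<Rightarrow> 'a" where "w f = (\<Sum>b\<in>Basis - {e}. f b *\<^sub>R b)" for f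
  have Basis_e: "insert e (Basis - {e}) = Basis" using e by auto
  have fubini: "(\<integral>\<^sup>+x. F x \<partial>lborel) =
      (\<integral>\<^sup>+f. (\<integral>\<^sup>+y. F (w f + y *\<^sub>R e) \<partial>lborel) \<partial>(\<Pi>\<^sub>M b\<in>Basis - {e}. lborel))"
    if [measurable]: "F \<in> borel_measurable borel" for F :: "'a \<Rightarrow> ennreal"
  proof -
    have split_e: "(\<Sum>b\<in>Basis. (f(e := y)) b *\<^sub>R b) = w f + y *\<^sub>R e" for f y
      using e by (subst sum.remove[of _ e]) (auto simp: w_def intro!: sum.cong)
    have "(\<integral>\<^sup>+x. F x \<partial>lborel) =
        (\<integral>\<^sup>+f. F (\<Sum>b\<in>Basis. f b *\<^sub>R b) \<partial>(\<Pi>\<^sub>M b\<in>insert e (Basis - {e}). lborel))"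
      unfolding Basis_e by (subst lborel_eq) (simp add: nn_integral_distr)
    also have "\<dots> = (\<integral>\<^sup>+f. (\<integral>\<^sup>+y. F (\<Sum>b\<in>Basis. (f(e := y)) b *\<^sub>R b) \<partial>lborel) \<partial>(\<Pi>\<^sub>M b\<in>Basis - {e}. lborel))"
      by (rule product_nn_integral_insert) (auto simp: Basis_e)
    also have "(\<integral>\<^sup>+f. (\<integral>\<^sup>+y. F (\<Sum>b\<in>Basis. (f(e := y)) b *\<^sub>R b) \<partial>lborel) \<partial>(\<Pi>\<^sub>M b\<in>Basis - {e}. lborel))
        = (\<integral>\<^sup>+f. (\<integral>\<^sup>+y. F (w f + y *\<^sub>R e) \<partial>lborel) \<partial>(\<Pi>\<^sub>M b\<in>Basis - {e}. lborel))"
      by (simp only: split_e)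
    finally show ?thesis .
  qed
  have shift: "(\<integral>\<^sup>+y. g (w f + (y + c) *\<^sub>R e) \<partial>lborel) = (\<integral>\<^sup>+y. g (w f + y *\<^sub>R e) \<partial>lborel)" for f c
    using nn_integral_real_affine[of "\<lambda>y. g (w f + y *\<^sub>R e)" 1 c] by (simp add: add.commute)
  have "(\<integral>\<^sup>+x. g (x + h x *\<^sub>R e) \<partial>lborel) =
      (\<integral>\<^sup>+f. (\<integral>\<^sup>+y. g (w f + (y + h (w f)) *\<^sub>R e) \<partial>lborel) \<partial>(\<Pi>\<^sub>M b\<in>Basis - {e}. lborel))"
    by (subst fubini) (auto simp: h_inv algebra_simps)
  also have "\<dots> = (\<integral>\<^sup>+x. g x \<partial>lborel)"
    by (simp only: shift fubini[OF g])
  finally show ?thesis .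
qed

lemma Basis_vec_eq_range_axis: "(Basis :: (real^'n) set) = range (\<lambda>i. axis i 1)"
  by (auto simp: Basis_vec_def)

lemma prod_Basis_vec:
  fixes F :: "real^'n \<Rightarrow> 'b::comm_monoid_mult"
  shows "(\<Prod>b\<in>Basis. F b) = (\<Prod>i\<in>UNIV. F (axis i 1))"
  unfolding Basis_vec_eq_range_axis by (subst prod.reindex) (auto simp: inj_on_def axis_eq_axis)

lemma nn_integral_lborel_swap:
  fixes g :: "real^'n \<Rightarrow> ennreal"
  assumes [measurable]: "g \<in> borel_measurable borel"
  shows "(\<integral>\<^sup>+x. g (\<chi> i. x $ Transposition.transpose m n i) \<partial>lborel) = (\<integral>\<^sup>+x. g x \<partial>lborel)"
proof -
  let ?s = "\<lambda>x::real^'n. \<chi> i. x $ Transposition.transpose m n i"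
  have [measurable]: "?s \<in> borel \<rightarrow>\<^sub>M borel"
    by (intro borel_measurable_continuous_onI continuous_intros)
  have "lborel = distr lborel borel ?s"
  proof (rule lborel_eqI)
    fix l u :: "real^'n"
    assume le: "\<And>b. b \<in> Basis \<Longrightarrow> l \<bullet> b \<le> u \<bullet> b"
    then have le': "l $ i \<le> u $ i" for i
      using le[of "axis i 1"] by (simp add: inner_axis)
    have "?s -` box l u = box (?s l) (?s u)"
      by (auto simp: mem_box_cart) (metis transpose_involutory)+
    then have "emeasure (distr lborel borel ?s) (box l u) = emeasure lborel (box (?s l) (?s u))"
      by (simp add: emeasure_distr)
    also have "\<dots> = (\<Prod>b\<in>Basis. (?s u - ?s l) \<bullet> b)"
      using le' by (intro emeasure_lborel_box) (auto simp: Basis_vec_eq_range_axis inner_axis)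
    also have "(\<Prod>b\<in>Basis. (?s u - ?s l) \<bullet> b) = (\<Prod>i\<in>UNIV. (u - l) $ Transposition.transpose m n i)"
      by (simp add: prod_Basis_vec inner_axis)
    also have "\<dots> = (\<Prod>i\<in>UNIV. (u - l) $ i)"
      using prod.permute[OF permutes_swap_id[of m UNIV n], of "\<lambda>i. (u - l) $ i"] by (simp add: o_def)
    finally show "emeasure (distr lborel borel ?s) (box l u) = (\<Prod>b\<in>Basis. (u - l) \<bullet> b)"
      by (simp add: prod_Basis_vec inner_axis)
  qed simp
  then have "(\<integral>\<^sup>+x. g x \<partial>lborel) = (\<integral>\<^sup>+x. g x \<partial>distr lborel borel ?s)" by simp
  also have "\<dots> = (\<integral>\<^sup>+x. g (?s x) \<partial>lborel)" by (simp add: nn_integral_distr)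
  finally show ?thesis ..
qed

lemma nn_integral_lborel_diagonal:
  fixes g :: "real^'n \<Rightarrow> ennreal"
  assumes [measurable]: "g \<in> borel_measurable borel" and d: "\<And>i. d i \<noteq> 0"
  shows "(\<integral>\<^sup>+x. g (\<chi> i. d i * x $ i) \<partial>lborel) * ennreal \<bar>\<Prod>i\<in>UNIV. d i\<bar> = (\<integral>\<^sup>+x. g x \<partial>lborel)"
proof -
  \<comment> \<open>the scaling factors, indexed by the basis vectors instead of the coordinates\<close>
  define c :: "real^'n \<Rightarrow> real" where "c b = (\<Sum>i\<in>UNIV. d i * b $ i)" for b
  have c: "c (axis i 1) = d i" for i
    by (simp add: c_def axis_def if_distrib cong: if_cong)
  let ?T = "\<lambda>x::real^'n. 0 + (\<Sum>b\<in>Basis. (c b * (x \<bullet> b)) *\<^sub>R b)"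
  have T: "?T x = (\<chi> i. d i * x $ i)" for x
  proof -
    have "?T x = (\<Sum>i\<in>UNIV. (d i * x $ i) *\<^sub>R axis i 1)"
      unfolding Basis_vec_eq_range_axis
      by (subst sum.reindex) (auto simp: inj_on_def axis_eq_axis c inner_axis)
    then show ?thesis by (simp add: vec_eq_iff axis_def if_distrib cong: if_cong)
  qed
  have "lborel = density (distr lborel borel ?T) (\<lambda>_. (\<Prod>b\<in>Basis. \<bar>c b\<bar>))"
    by (rule lborel_affine_euclidean) (auto simp: Basis_vec_eq_range_axis c d)
  then have "(\<integral>\<^sup>+x. g x \<partial>lborel) =
      (\<integral>\<^sup>+x. g x \<partial>density (distr lborel borel ?T) (\<lambda>_. (\<Prod>b\<in>Basis. \<bar>c b\<bar>)))" by simp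
  also have "\<dots> = ennreal (\<Prod>b\<in>Basis. \<bar>c b\<bar>) * (\<integral>\<^sup>+x. g (?T x) \<partial>lborel)"
    by (simp add: nn_integral_density nn_integral_distr nn_integral_cmult)
  finally show ?thesis
    unfolding T by (simp add: prod_Basis_vec c abs_prod mult.commute)
qed

lemma measurable_matrix_vector_mult[measurable]: "(*v) A \<in> borel_measurable borel"
  for A :: "real^'n^'m"
  by (intro borel_measurable_continuous_onI matrix_vector_mult_linear_continuous_on)

text \<open>
  Both sides are compatible with matrix products, so it suffices to treat the generators: diagonal
  matrices, coordinate swaps and elementary shears.
\<close>

lemma nn_integral_lborel_matrix:
  fixes A :: "real^'n^'n"
  assumes "det A \<noteq> 0" and "g \<in> borel_measurable borel"
  shows "(\<integral>\<^sup>+x. g (A *v x) \<partial>lborel) * ennreal \<bar>det A\<bar> = (\<integral>\<^sup>+x. g x \<partial>lborel)"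
proof -
  have "det A \<noteq> 0 \<longrightarrow> (\<forall>g\<in>borel_measurable borel.
      (\<integral>\<^sup>+x. g (A *v x) \<partial>lborel) * ennreal \<bar>det A\<bar> = (\<integral>\<^sup>+x. g x \<partial>lborel))"
  proof (induction A rule: induct_matrix_elementary_alt)
    case (1 A B)
    show ?case
    proof (intro impI ballI)
      fix g :: "real^'n \<Rightarrow> ennreal"
      assume "det (A ** B) \<noteq> 0" and [measurable]: "g \<in> borel_measurable borel"
      then have "det A \<noteq> 0" "det B \<noteq> 0" by (auto simp: det_mul)
      have "(\<integral>\<^sup>+x. g (A *v (B *v x)) \<partial>lborel) * ennreal \<bar>det B\<bar> = (\<integral>\<^sup>+x. g (A *v x) \<partial>lborel)"
        using 1(2) \<open>det B \<noteq> 0\<close> by (auto elim!: ballE[of _ _ "\<lambda>x. g (A *v x)"])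
      moreover have "(\<integral>\<^sup>+x. g (A *v x) \<partial>lborel) * ennreal \<bar>det A\<bar> = (\<integral>\<^sup>+x. g x \<partial>lborel)"
        using 1(1) \<open>det A \<noteq> 0\<close> by auto
      ultimately show "(\<integral>\<^sup>+x. g (A ** B *v x) \<partial>lborel) * ennreal \<bar>det (A ** B)\<bar> = (\<integral>\<^sup>+x. g x \<partial>lborel)"
        by (simp add: det_mul abs_mult ennreal_mult matrix_vector_mul_assoc[symmetric]
            mult.commute[of "ennreal \<bar>det A\<bar>"] mult.assoc[symmetric])
    qed
  next
    case (2 A i)
    then show ?case by (simp add: det_zero_row)
  next
    case (3 A)
    have "(\<Prod>i\<in>UNIV. A $ i $ i) \<noteq> 0 \<longrightarrow> A $ i $ i \<noteq> 0" for i by auto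
    moreover have "A *v x = (\<chi> i. A $ i $ i * x $ i)" for x
    proof -
      have "(\<Sum>j\<in>UNIV. A $ i $ j * x $ j) = (\<Sum>j\<in>{i}. A $ i $ j * x $ j)" for i
        using 3 by (intro sum.mono_neutral_right) auto
      then show ?thesis by (simp add: matrix_vector_mult_def)
    qed
    ultimately show ?case
      using 3 by (auto simp: det_diagonal intro!: nn_integral_lborel_diagonal)
  next
    case (4 m n)
    let ?S = "(\<chi> i j. mat 1 $ i $ Transposition.transpose m n j) :: real^'n^'n"
    have "?S *v x = (\<chi> i. x $ Transposition.transpose m n i)" for x
    proof -
      have "(\<Sum>j\<in>UNIV. mat 1 $ i $ Transposition.transpose m n j * x $ j)
          = (\<Sum>j\<in>UNIV. if j = Transposition.transpose m n i then x $ j else 0)" for i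
        by (intro sum.cong) (auto simp: mat_def)
      then show ?thesis by (simp add: matrix_vector_mult_def)
    qed
    moreover have "\<bar>det ?S\<bar> = 1"
      using \<open>m \<noteq> n\<close> by (simp add: det_permute_columns permutes_swap_id sign_swap_id abs_mult)
    ultimately show ?case by (simp add: nn_integral_lborel_swap)
  next
    case (5 m n)
    let ?E = "(\<chi> i j. of_bool (i = m \<and> j = n \<or> i = j)) :: real^'n^'n"
    have "?E = (\<chi> k. if k = m then row m (mat 1) + 1 *s row n (mat 1) else row k (mat 1))"
      using \<open>m \<noteq> n\<close> by (auto simp: vec_eq_iff row_def mat_def)
    then have "det ?E = 1"
      by (simp only: det_row_operation[OF \<open>m \<noteq> n\<close>] det_I)
    moreover have "?E *v x = x + (x $ n) *\<^sub>R axis m 1" for x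
    proof -
      have "(\<Sum>j\<in>UNIV. of_bool (i = m \<and> j = n \<or> i = j) * x $ j)
          = (\<Sum>j\<in>UNIV. (if i = j then x $ j else 0) + (if j = n then (if i = m then x $ j else 0) else 0))" for i
        using \<open>m \<noteq> n\<close> by (intro sum.cong) auto
      then show ?thesis
        by (simp add: vec_eq_iff matrix_vector_mult_def sum.distrib axis_def del: of_bool_or_iff)
    qed
    moreover have "(\<integral>\<^sup>+x. g (x + (x $ n) *\<^sub>R axis m 1) \<partial>lborel) = (\<integral>\<^sup>+x. g x \<partial>lborel)"
      if "g \<in> borel_measurable borel" for g :: "real^'n \<Rightarrow> ennreal"
      using \<open>m \<noteq> n\<close> that
      by (intro nn_integral_lborel_shear) (auto simp: Basis_vec_eq_range_axis axis_def)
    ultimately show ?case by simp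
  qed
  with assms show ?thesis by blast
qed

section \<open>Linear functionals of a Gaussian vector\<close>

lemma pos_def_matrix_inner_commute:
  assumes "pos_def_matrix P"
  shows "x \<bullet> (P *v y) = y \<bullet> (P *v x)"
  using assms unfolding pos_def_matrix_def
  by (metis dot_lmul_matrix inner_commute transpose_matrix_vector)

text \<open>
  Each new vector is taken orthogonal, in the Euclidean sense, to the images \<open>P *v v j\<close> of the earlier
  ones. As long as an index is left, these images span a proper subspace, so such a vector exists;
  positive definiteness allows normalising it. The vector \<open>u\<close> is placed first, at index \<open>k\<close>, so that
  it survives unchanged.
\<close>

lemma pos_def_orthonormal_family:
  fixes P :: "real^'n^'n"
  assumes P: "pos_def_matrix P" and u: "u \<bullet> (P *v u) = 1" and "finite (J :: 'n set)"
  shows "\<exists>v. v k = u \<and>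
    (\<forall>i\<in>insert k J. \<forall>j\<in>insert k J. v i \<bullet> (P *v v j) = (if i = j then 1 else 0 :: real))"
  using \<open>finite J\<close>
proof (induction J rule: finite_induct)
  case empty
  show ?case using u by (intro exI[of _ "\<lambda>_. u"]) auto
next
  case (insert m J)
  then obtain v where v: "v k = u"
    "\<And>i j. i \<in> insert k J \<Longrightarrow> j \<in> insert k J \<Longrightarrow> v i \<bullet> (P *v v j) = (if i = j then 1 else 0)"
    by blast
  show ?case
  proof (cases "m = k")
    case True
    with v show ?thesis by (intro exI[of _ v]) auto
  next
    case False
    with insert.hyps have m: "m \<notin> insert k J" by simp
    let ?S = "(\<lambda>j. P *v v j) ` insert k J"
    have "dim ?S \<le> card (insert k J)"
      using insert.hyps by (intro order.trans[OF dim_le_card'] card_image_le) auto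
    moreover have "insert k J \<subset> UNIV" using m by blast
    then have "card (insert k J) < CARD('n)" by (intro psubset_card_mono) auto
    ultimately have "dim ?S < DIM(real^'n)" by simp
    then obtain w where w: "w \<noteq> 0" "\<And>y. y \<in> span ?S \<Longrightarrow> orthogonal w y"
      by (rule orthogonal_to_subspace_exists) blast
    have wv: "w \<bullet> (P *v v j) = 0" if "j \<in> insert k J" for j
      using w(2)[OF span_base, of "P *v v j"] that by (auto simp: orthogonal_def)
    define s where "s = w \<bullet> (P *v w)"
    have s: "0 < s" using P w(1) by (auto simp: pos_def_matrix_def s_def)
    define v' where "v' = v(m := (1 / sqrt s) *\<^sub>R w)"
    have "v' m \<bullet> (P *v v' m) = 1"
      using s by (simp add: v'_def matrix_vector_mult_scaleR flip: s_def)
    moreover have "v' m \<bullet> (P *v v' j) = 0" "v' j \<bullet> (P *v v' m) = 0" if "j \<in> insert k J" for j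
      using that m wv[OF that] pos_def_matrix_inner_commute[OF P, of "v' m" "v' j"]
      by (auto simp: v'_def)
    moreover have "v' i \<bullet> (P *v v' j) = (if i = j then 1 else 0)"
      if "i \<in> insert k J" "j \<in> insert k J" for i j
      using that m v(2)[OF that] by (auto simp: v'_def)
    moreover have "v' k = u" using False v(1) by (simp add: v'_def)
    ultimately show ?thesis
      using m by (intro exI[of _ v']) (auto simp: insert_commute[of k m])
  qed
qed

text \<open>
  The matrix \<open>V\<close> maps a centred Gaussian vector with covariance \<open>P\<close> to a standard one; prescribing one
  row makes a prescribed functional a coordinate of the result.
\<close>

lemma pos_def_whitening:
  fixes P :: "real^'n^'n"
  assumes P: "pos_def_matrix P" and u: "u \<bullet> (P *v u) = 1"
  obtains V :: "real^'n^'n" where "V ** (P ** transpose V) = mat 1" and "V $ k = u"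
proof -
  obtain v where v: "v k = u" "\<And>i j. v i \<bullet> (P *v v j) = (if i = j then 1 else 0)"
    using pos_def_orthonormal_family[OF P u finite, of k UNIV] by auto
  define V :: "real^'n^'n" where "V = (\<chi> i. v i)"
  have col: "column j (P ** transpose V) = P *v v j" for j
    by (simp add: V_def column_def matrix_matrix_mult_def matrix_vector_mult_def transpose_def vec_eq_iff)
  have "(V ** B) $ i $ j = v i \<bullet> column j B" for B :: "real^'n^'n" and i j
    by (simp add: V_def column_def matrix_matrix_mult_def inner_vec_def)
  then have "(V ** (P ** transpose V)) $ i $ j = v i \<bullet> (P *v v j)" for i j
    by (simp only: col)
  then have "V ** (P ** transpose V) = mat 1"
    by (simp add: vec_eq_iff mat_def v(2))
  moreover have "V $ k = u" by (simp add: V_def v(1))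
  ultimately show ?thesis by (rule that)
qed

text \<open>
  From \<open>V ** (P ** transpose V) = mat 1\<close> follow \<open>matrix_inv P = transpose V ** V\<close> and
  \<open>det P = 1 / (det V)\<^sup>2\<close>: the exponent becomes the squared norm of \<open>V *v (x - \<mu>)\<close>, and the
  normalising constant supplies the Jacobian factor.
\<close>

lemma gaussian_density_whitened:
  fixes P V :: "real^'n^'n"
  assumes V: "V ** (P ** transpose V) = mat 1"
  shows "gaussian_density \<mu> P x = \<bar>det V\<bar> * (\<Prod>i\<in>UNIV. std_normal_density ((V *v (x - \<mu>)) $ i))"
    and "det V \<noteq> 0" and "0 < gaussian_density \<mu> P x"
proof -
  have "P ** (transpose V ** V) = mat 1"
    using V by (metis matrix_left_right_inverse matrix_mul_assoc)
  then have "(transpose V ** V) ** P = mat 1"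
    by (simp add: matrix_left_right_inverse)
  then have inv: "matrix_inv P = transpose V ** V"
    unfolding matrix_inv_def using \<open>P ** (transpose V ** V) = mat 1\<close>
    by (intro some_equality) (auto, metis matrix_mul_assoc matrix_mul_lid matrix_mul_rid)
  have "det V * (det P * det V) = 1"
    using arg_cong[OF V, of det] by (simp add: det_mul)
  then have V0: "det V \<noteq> 0" and detP: "det P = 1 / (det V)\<^sup>2"
    by (auto simp: eq_divide_eq power2_eq_square ac_simps)
  let ?y = "V *v (x - \<mu>)"
  have quad: "(x - \<mu>) \<bullet> (matrix_inv P *v (x - \<mu>)) = (\<Sum>i\<in>UNIV. (?y $ i)\<^sup>2)"
  proof -
    have "(x - \<mu>) \<bullet> (transpose V *v ?y) = ?y \<bullet> ?y"
      by (metis dot_lmul_matrix inner_commute transpose_matrix_vector)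
    then show ?thesis
      by (simp add: inv inner_vec_def power2_eq_square matrix_vector_mul_assoc[symmetric])
  qed
  have norm: "sqrt ((2 * pi) ^ CARD('n) * det P) = sqrt (2 * pi) ^ CARD('n) / \<bar>det V\<bar>"
  proof -
    have "sqrt (det P) = 1 / \<bar>det V\<bar>" by (simp add: detP real_sqrt_divide)
    then show ?thesis by (simp only: real_sqrt_mult[of "_ ^ _"] real_sqrt_power) simp
  qed
  have "(\<Prod>i\<in>UNIV. std_normal_density (?y $ i))
      = exp (- (1/2) * (\<Sum>i\<in>UNIV. (?y $ i)\<^sup>2)) / sqrt (2 * pi) ^ CARD('n)"
    unfolding std_normal_density_def
    by (simp add: prod.distrib prod_dividef exp_sum[symmetric] sum_divide_distrib[symmetric] sum_negf)
  then show eq: "gaussian_density \<mu> P x = \<bar>det V\<bar> * (\<Prod>i\<in>UNIV. std_normal_density (?y $ i))"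
    unfolding gaussian_density_def quad norm by simp
  show "det V \<noteq> 0" by (rule V0)
  show "0 < gaussian_density \<mu> P x"
    unfolding eq using V0 by (auto intro!: mult_pos_pos prod_pos normal_density_pos)
qed

lemma nn_integral_std_normal_product:
  fixes B :: "real set" and k :: "'n::finite"
  assumes [measurable]: "B \<in> sets borel"
  shows "(\<integral>\<^sup>+y. ennreal (\<Prod>i\<in>UNIV. std_normal_density ((y :: real^'n) $ i)) * indicator B (y $ k) \<partial>lborel)
    = emeasure std_normal_distribution B"
proof -
  define f where "f b z = ennreal (std_normal_density z) * (if b = axis k 1 then indicator B z else 1)"
    for b :: "real^'n" and z
  have "(\<Prod>b\<in>Basis. f b (y \<bullet> b)) =
      ennreal (\<Prod>i\<in>UNIV. std_normal_density (y $ i)) * indicator B (y $ k)" for y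
    by (simp add: prod_Basis_vec f_def inner_axis axis_eq_axis prod.distrib prod_ennreal)
  then have "(\<integral>\<^sup>+y. ennreal (\<Prod>i\<in>UNIV. std_normal_density ((y :: real^'n) $ i)) * indicator B (y $ k) \<partial>lborel)
      = (\<integral>\<^sup>+y. (\<Prod>b\<in>Basis. f b (y \<bullet> b)) \<partial>lborel)" by simp
  also have "\<dots> = (\<Prod>b\<in>Basis. (\<integral>\<^sup>+z. f b z \<partial>lborel))"
    by (rule nn_integral_lborel_prod) (auto simp: f_def)
  also have "\<dots> = (\<Prod>i\<in>UNIV. if i = k then emeasure std_normal_distribution B else 1)"
  proof -
    have "(\<integral>\<^sup>+z. ennreal (std_normal_density z) \<partial>lborel) = 1"
      using prob_space.emeasure_space_1[OF prob_space_normal_density[of 1 0]]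
      by (simp add: emeasure_density)
    then have "(\<integral>\<^sup>+z. f (axis i 1) z \<partial>lborel)
        = (if i = k then emeasure std_normal_distribution B else 1)" for i
      by (simp add: f_def axis_eq_axis emeasure_density)
    then show ?thesis by (simp add: prod_Basis_vec)
  qed
  finally show ?thesis by simp
qed

text \<open>
  This says that \<open>u \<bullet> (x - \<mu>)\<close> is standard normal. Taking \<open>B = UNIV\<close> gives the normalisation of the
  Gaussian density, and a half-line gives the probability of a halfspace.
\<close>

lemma nn_integral_gaussian_linear_functional:
  fixes P :: "real^'n^'n"
  assumes P: "pos_def_matrix P" and u: "u \<bullet> (P *v u) = 1" and [measurable]: "B \<in> sets borel"
  shows "(\<integral>\<^sup>+x. ennreal (gaussian_density \<mu> P x) * indicator B (u \<bullet> (x - \<mu>)) \<partial>lborel)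
    = emeasure std_normal_distribution B"
proof -
  \<comment> \<open>any coordinate will do\<close>
  define k where "k = (undefined :: 'n)"
  obtain V :: "real^'n^'n" where V: "V ** (P ** transpose V) = mat 1" and Vk: "V $ k = u"
    using pos_def_whitening[OF P u] by blast
  define g where "g y = ennreal (\<Prod>i\<in>UNIV. std_normal_density ((y :: real^'n) $ i)) * indicator B (y $ k)" for y
  have [measurable]: "g \<in> borel_measurable borel" unfolding g_def by measurable
  have "(V *v y) $ k = u \<bullet> y" for y by (simp add: matrix_vector_mul_component Vk)
  then have "(\<integral>\<^sup>+x. ennreal (gaussian_density \<mu> P x) * indicator B (u \<bullet> (x - \<mu>)) \<partial>lborel)
      = (\<integral>\<^sup>+x. g (V *v (x - \<mu>)) * ennreal \<bar>det V\<bar> \<partial>lborel)"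
    by (simp add: gaussian_density_whitened(1)[OF V] g_def ennreal_mult prod_nonneg ac_simps)
  also have "\<dots> = (\<integral>\<^sup>+x. g (V *v (x - \<mu>)) \<partial>distr lborel borel ((+) \<mu>)) * ennreal \<bar>det V\<bar>"
    by (simp add: nn_integral_multc lborel_distr_plus)
  also have "\<dots> = (\<integral>\<^sup>+x. g (V *v x) \<partial>lborel) * ennreal \<bar>det V\<bar>"
    by (simp add: nn_integral_distr)
  also have "\<dots> = emeasure std_normal_distribution B"
    using nn_integral_lborel_matrix[OF gaussian_density_whitened(2)[OF V], of g]
    by (simp add: g_def nn_integral_std_normal_product)
  finally show ?thesis .
qed

lemma borel_measurable_gaussian_density[measurable]: "gaussian_density \<mu> P \<in> borel_measurable borel"
  unfolding gaussian_density_def by measurable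

theorem mainTheorem2:
  fixes \<mu> a :: "real^'n" and P :: "real^'n^'n" and b lam :: real
    and \<pi> :: "real^'n \<Rightarrow> real" and S :: "(real^'n) set"
  assumes "pos_def_matrix P"
    and "a \<bullet> (P *v a) > 0"
    and "S = {x. a \<bullet> x \<le> b}"
    and "prob_density \<pi>"
    and "relative_entropy \<pi> (gaussian_density \<mu> P) < \<infinity>"
    and "lam > 0"
  shows "ereal (measure (density lborel (\<lambda>x. ennreal (\<pi> x))) {x. x \<notin> S})
    \<le> 1 + ereal (1 / lam) *
        (ereal (ln (1 - (1 - exp (- lam)) *
           cdf std_normal_distribution ((b - a \<bullet> \<mu>) / sqrt (a \<bullet> (P *v a)))))
         + relative_entropy \<pi> (gaussian_density \<mu> P))"
proof -
  let ?q = "gaussian_density \<mu> P"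
  define \<sigma> where "\<sigma> = sqrt (a \<bullet> (P *v a))"
  define u where "u = (1 / \<sigma>) *\<^sub>R a"
  define \<Phi> where "\<Phi> = cdf std_normal_distribution ((b - a \<bullet> \<mu>) / \<sigma>)"
  have \<sigma>: "0 < \<sigma>" "\<sigma>\<^sup>2 = a \<bullet> (P *v a)" using assms(2) by (auto simp: \<sigma>_def)
  then have u: "u \<bullet> (P *v u) = 1"
    using assms(2) by (simp add: u_def matrix_vector_mult_scaleR power2_eq_square[symmetric])
  interpret N: prob_space std_normal_distribution by (rule prob_space_normal_density) simp
  note q_functional = nn_integral_gaussian_linear_functional[OF assms(1) u]
  have qpos: "0 < ?q x" for x
    using pos_def_whitening[OF assms(1) u] gaussian_density_whitened(3) by metis
  have q: "prob_density ?q"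
    using q_functional[of UNIV \<mu>] N.emeasure_space_1 qpos
    by (simp add: prob_density_def less_imp_le)
  have [measurable]: "S \<in> sets borel" unfolding assms(3) by measurable
  have [measurable]: "\<pi> \<in> borel_measurable borel" and \<pi>0: "\<And>x. 0 \<le> \<pi> x"
    using assms(4) by (auto simp: prob_density_def)
  note iq = prob_density_integral[OF q] and ip = prob_density_integral[OF assms(4)]

  have "indicator {..(b - a \<bullet> \<mu>) / \<sigma>} (u \<bullet> (x - \<mu>)) = (indicator S x :: ennreal)" for x
    using \<sigma>(1) by (auto simp: indicator_def assms(3) u_def inner_diff_right divide_le_cancel field_simps)
  then have "(\<integral>\<^sup>+x. ennreal (?q x * indicator S x) \<partial>lborel) = ennreal \<Phi>"
    using q_functional[of "{..(b - a \<bullet> \<mu>) / \<sigma>}" \<mu>]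
    by (simp add: ennreal_mult' qpos less_imp_le ennreal_indicator \<Phi>_def cdf_def N.emeasure_eq_measure)
  then have qS: "(\<integral>x. ?q x * indicator S x \<partial>lborel) = \<Phi>"
    using qpos by (intro integral_eq_nn_integral[THEN trans]) (auto simp: less_imp_le \<Phi>_def cdf_def)
  have iqS: "integrable lborel (\<lambda>x. ?q x * indicator S x)"
    using integrable_real_mult_indicator[OF _ iq(1), of S] by simp
  have ipS: "integrable lborel (\<lambda>x. \<pi> x * indicator S x)"
    using integrable_real_mult_indicator[OF _ ip(1), of S] by simp

  let ?f = "\<lambda>x. - lam * indicator S x"
  have "ereal (\<integral>x. \<pi> x * ?f x \<partial>lborel)
      \<le> ereal (ln (\<integral>x. ?q x * exp (?f x) \<partial>lborel)) + relative_entropy \<pi> ?q"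
    using assms(6)
    by (intro donsker_varadhan_le[OF assms(4) q qpos assms(5), of _ lam]) (auto simp: indicator_def)
  also have "(\<integral>x. ?q x * exp (?f x) \<partial>lborel)
      = (\<integral>x. ?q x - (1 - exp (- lam)) * (?q x * indicator S x) \<partial>lborel)"
    by (intro Bochner_Integration.integral_cong) (auto simp: indicator_def algebra_simps)
  also have "\<dots> = 1 - (1 - exp (- lam)) * \<Phi>"
    using iq iqS by (simp add: qS)
  finally have dv: "ereal (\<integral>x. \<pi> x * ?f x \<partial>lborel)
      \<le> ereal (ln (1 - (1 - exp (- lam)) * \<Phi>)) + relative_entropy \<pi> ?q" .

  have "(\<integral>x. \<pi> x * indicator (- S) x \<partial>lborel) = (\<integral>x. \<pi> x - \<pi> x * indicator S x \<partial>lborel)"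
    by (intro Bochner_Integration.integral_cong) (auto simp: indicator_def)
  also have "\<dots> = 1 - (\<integral>x. \<pi> x * indicator S x \<partial>lborel)"
    using ip ipS by simp
  also have "(\<integral>x. \<pi> x * indicator (- S) x \<partial>lborel)
      = measure (density lborel (\<lambda>x. ennreal (\<pi> x))) {x. x \<notin> S}"
  proof -
    have "emeasure (density lborel (\<lambda>x. ennreal (\<pi> x))) (- S) = (\<integral>\<^sup>+x. ennreal (\<pi> x * indicator (- S) x) \<partial>lborel)"
      by (simp add: emeasure_density ennreal_mult' \<pi>0 ennreal_indicator)
    then show ?thesis
      using \<pi>0 by (simp add: measure_def integral_eq_nn_integral Compl_eq)
  qed
  finally have out: "measure (density lborel (\<lambda>x. ennreal (\<pi> x))) {x. x \<notin> S}
      = 1 - (\<integral>x. \<pi> x * indicator S x \<partial>lborel)" .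
  have pf: "(\<integral>x. \<pi> x * ?f x \<partial>lborel) = - lam * (\<integral>x. \<pi> x * indicator S x \<partial>lborel)"
    by (simp add: algebra_simps flip: integral_mult_right_zero)
  obtain R where R: "relative_entropy \<pi> ?q = ereal R"
    using relative_entropy_eq_integral(2)[OF assms(4) q qpos assms(5)] by blast
  show ?thesis
    using dv assms(6) unfolding out pf R \<Phi>_def[symmetric] \<sigma>_def[symmetric]
    by (simp add: one_ereal_def field_simps)
qed
end
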